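(* Let $n\ge 2$, let $I\subset\mathbb{R}$ be an open interval, let $S\subseteq\{0,1,\ldots,n-1\}$, and let $f\in C^n(I)$ be a real-valued function such that the inequality $$f(a_1)+f(a_2)+\ldots+f(a_n)\le f(b_1)+f(b_2)+\ldots+f(b_n)$$ holds for all $a,b\in\Delta_n$ satisfying $$E_k(a)\le E_k(b)\ \text{ for } k\in S\qquad\text{and}\qquad E_k(a)=E_k(b)\ \text{ for } k\in\{0,1,\ldots,n-1\}\setminus S.$$ Then $$(-1)^{n+k}\,(x^k f'(x))^{(n-1)}\le 0\quad\text{for all }x\in I\text{ and all }k\in S,$$ where $(\cdot)^{(n-1)}$ denotes the $(n-1)$-st derivative with respect to $x$.
   Context: For $n\ge2$ and $k\in\{0,1,\ldots,n-1\}$, $E_k(y_1,\ldots,y_n)=\sum_{1\le i_1<\ldots<i_{n-k}\le n} y_{i_1}y_{i_2}\cdots y_{i_{n-k}}$ is the elementary symmetric polynomial of degree $n-k$ (so $E_0=y_1\cdots y_n$ and $E_{n-1}=y_1+\ldots+y_n$). For an open interval $I\subset\mathbb{R}$, $\Delta_n=\{y=(y_1,\ldots,y_n)\in I^n : y_1\le y_2\le\ldots\le y_n\}$. *)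

theory Defs
  imports "HOL-Analysis.Analysis"
begin

text \<open>Points of $R^n$ are functions on the index set \<open>{1..n}\<close>, extensional outside of it.\<close>

definition elem_sym :: "nat \<Rightarrow> nat \<Rightarrow> (nat \<Rightarrow> real) \<Rightarrow> real" where
  "elem_sym n k y = (\<Sum>A | A \<subseteq> {1..n} \<and> card A = n - k. \<Prod>i\<in>A. y i)"

definition ordered_tuples :: "nat \<Rightarrow> real set \<Rightarrow> (nat \<Rightarrow> real) set" where
  "ordered_tuples n I = {y \<in> {1..n} \<rightarrow>\<^sub>E I. mono_on {1..n} y}"

text \<open>
  The notion \<open>C_on m I f\<close> is meant for open \<open>I\<close>: the iterated two-sided derivatives at points
  of \<open>I\<close> then depend only on the values of \<open>f\<close> on \<open>I\<close>. The differentiability clause is needed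
  because \<^const>\<open>deriv\<close> is total. Continuity of the derivatives of order below \<open>m\<close> follows
  from their differentiability.
\<close>

definition C_on :: "nat \<Rightarrow> real set \<Rightarrow> (real \<Rightarrow> real) \<Rightarrow> bool" where
  "C_on m I f \<longleftrightarrow>
     (\<forall>j<m. \<forall>x\<in>I. (deriv ^^ j) f field_differentiable at x) \<and> continuous_on I ((deriv ^^ m) f)"

end

theory Submission
  imports Defs
begin

text \<open>
  If $P(t) = \prod_i (t - a_i)$ has distinct roots in $I$, then for small $e > 0$ the polynomial
  $P(t) + (-1)^{n-k} e t^k$ has distinct roots $b_i$ near the $a_i$, and $E_j(b) = E_j(a)$
  except that $E_k(b) = E_k(a) + e$. The hypothesis gives $\sum_i (f(b_i) - f(a_i)) / e \ge 0$, and
  letting $e \to 0$ yields $(-1)^{n-k} \sum_i a_i^k f'(a_i) / P'(a_i) \le 0$. The sum is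
  the divided difference of $g(t) = t^k f'(t)$ at the nodes $a_i$. For the nodes
  $a_i = x + i h$ it equals $g^{(n-1)}(\xi) / (n-1)!$ with $\xi$ near $x$; then $h \to 0$.
\<close>

section \<open>Closure of \<open>C_on\<close> under sums, products and powers\<close>

lemma C_on_cong:
  assumes "open I" and eq: "\<And>t. t \<in> I \<Longrightarrow> f t = g t" and f: "C_on m I f"
  shows "C_on m I g"
proof -
  have eq': "(deriv ^^ j) f x = (deriv ^^ j) g x" if "x \<in> I" for j x
    using eventually_nhds_in_open[OF \<open>open I\<close> that]
    by (intro higher_deriv_cong_ev) (auto elim!: eventually_mono simp: eq)
  have "(deriv ^^ j) g field_differentiable at x" if "j < m" "x \<in> I" for j x
  proof -
    have "(deriv ^^ j) f field_differentiable at x"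
      using f that by (simp add: C_on_def)
    then obtain D where "((deriv ^^ j) f has_field_derivative D) (at x)"
      by (auto simp: field_differentiable_def)
    then have "((deriv ^^ j) g has_field_derivative D) (at x)"
      by (rule has_field_derivative_transform_within_open[OF _ \<open>open I\<close> \<open>x \<in> I\<close> eq'])
    then show ?thesis
      unfolding field_differentiable_def by blast
  qed
  moreover have "continuous_on I ((deriv ^^ m) g)"
    using f continuous_on_cong[of I I "(deriv ^^ m) f" "(deriv ^^ m) g"] eq' by (simp add: C_on_def)
  ultimately show ?thesis
    unfolding C_on_def by blast
qed

lemma C_on_0: "C_on 0 I f \<longleftrightarrow> continuous_on I f"
  unfolding C_on_def by simp

text \<open>Peeling off the derivative nearest to \<open>f\<close>, rather than the outermost one,
  lets the inductions over \<open>m\<close> below apply their hypothesis to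
  \<open>deriv f\<close>.\<close>

lemma C_on_Suc:
  "C_on (Suc m) I f \<longleftrightarrow> (\<forall>x\<in>I. f field_differentiable at x) \<and> C_on m I (deriv f)"
  unfolding C_on_def by (simp add: All_less_Suc2 funpow_Suc_right del: funpow.simps)

lemma C_on_lower: "C_on (Suc m) I f \<Longrightarrow> C_on m I f"
  unfolding C_on_def
  by (auto intro!: continuous_at_imp_continuous_on field_differentiable_imp_continuous_at)

lemma C_on_add:
  assumes "open I" "C_on m I f" "C_on m I g"
  shows "C_on m I (\<lambda>t. f t + g t)"
  using assms(2,3)
proof (induction m arbitrary: f g)
  case 0
  then show ?case by (auto simp: C_on_0 intro!: continuous_intros)
next
  case (Suc m)
  then have "C_on m I (\<lambda>t. deriv f t + deriv g t)"
    by (simp add: C_on_Suc)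
  \<comment> \<open>The sum rule for \<open>deriv\<close> is available only at points of
    \<open>I\<close>, so the two functions agree there but perhaps not elsewhere;
    \<open>C_on_cong\<close> bridges this.\<close>
  then have "C_on m I (deriv (\<lambda>t. f t + g t))"
    by (rule C_on_cong[OF \<open>open I\<close>, rotated]) (use Suc.prems in \<open>simp add: C_on_Suc\<close>)
  then show ?case
    using Suc.prems by (auto simp: C_on_Suc intro!: derivative_intros)
qed

lemma C_on_mult:
  assumes "open I" "C_on m I f" "C_on m I g"
  shows "C_on m I (\<lambda>t. f t * g t)"
  using assms(2,3)
proof (induction m arbitrary: f g)
  case 0
  then show ?case by (auto simp: C_on_0 intro!: continuous_intros)
next
  case (Suc m)
  then have "C_on m I (\<lambda>t. f t * deriv g t)" "C_on m I (\<lambda>t. deriv f t * g t)"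
    using C_on_lower by (auto simp: C_on_Suc)
  then have "C_on m I (\<lambda>t. f t * deriv g t + deriv f t * g t)"
    by (rule C_on_add[OF \<open>open I\<close>])
  then have "C_on m I (deriv (\<lambda>t. f t * g t))"
    by (rule C_on_cong[OF \<open>open I\<close>, rotated]) (use Suc.prems in \<open>simp add: C_on_Suc\<close>)
  then show ?case
    using Suc.prems by (auto simp: C_on_Suc intro!: derivative_intros)
qed

lemma C_on_const: "C_on m I (\<lambda>_. c)"
  by (induction m arbitrary: c) (auto simp: C_on_0 C_on_Suc)

lemma C_on_ident: "C_on m I (\<lambda>t. t)"
  by (cases m) (auto simp: C_on_0 C_on_Suc C_on_const)

lemma C_on_power: "open I \<Longrightarrow> C_on m I (\<lambda>t. t ^ k)"
  by (induction k) (auto simp: C_on_const intro!: C_on_mult C_on_ident)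

section \<open>Finite differences and equispaced nodes\<close>

lemma alternating_binomial_sum_Suc:
  fixes u :: "nat \<Rightarrow> 'a::comm_ring_1"
  shows "(\<Sum>i\<le>Suc m. (-1) ^ (Suc m + i) * of_nat (Suc m choose i) * u i) =
    (\<Sum>i\<le>m. (-1) ^ (m + i) * of_nat (m choose i) * (u (Suc i) - u i))"
proof -
  \<comment> \<open>The extra term at \<open>Suc m\<close> is zero because of its binomial
    coefficient. It is there so that, after the shift, every sum runs up to \<open>m\<close> and
    Pascal's rule applies termwise.\<close>
  have "(\<Sum>i\<le>Suc m. (-1) ^ (m + i) * of_nat (m choose i) * u i) =
      (-1) ^ m * u 0 - (\<Sum>i\<le>m. (-1) ^ (m + i) * of_nat (m choose Suc i) * u (Suc i))"
    by (subst sum.atMost_Suc_shift) (simp add: sum_negf)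
  then have "(\<Sum>i\<le>m. (-1) ^ (m + i) * of_nat (m choose i) * u i) =
      (-1) ^ m * u 0 - (\<Sum>i\<le>m. (-1) ^ (m + i) * of_nat (m choose Suc i) * u (Suc i))"
    by (simp add: binomial_eq_0)
  then show ?thesis
    by (subst sum.atMost_Suc_shift)
       (simp add: algebra_simps sum.distrib sum_subtractf sum_negf)
qed

text \<open>Induction on the order of the difference: the difference of order \<open>Suc m\<close>
  is the increment over [x, x+h] of the difference \<phi> of order \<open>m\<close>. The mean value
  theorem turns it into h * \<phi>'(\<eta>), and \<phi>'(\<eta>) is the difference of order
  \<open>m\<close> of \<open>deriv g\<close> with base point \<eta>, to which the induction
  hypothesis applies.\<close>

lemma finite_difference_mean_value:
  fixes g :: "real \<Rightarrow> real"
  assumes "h > 0"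
    and "\<And>j t. j < m \<Longrightarrow> t \<in> {x..x + real m * h} \<Longrightarrow> (deriv ^^ j) g field_differentiable at t"
  shows "\<exists>\<xi>\<in>{x..x + real m * h}.
    (\<Sum>i\<le>m. (-1) ^ (m + i) * real (m choose i) * g (x + real i * h)) = h ^ m * (deriv ^^ m) g \<xi>"
  using assms(2)
proof (induction m arbitrary: g x)
  case 0
  then show ?case by simp
next
  case (Suc m)
  define \<phi> where "\<phi> t = (\<Sum>i\<le>m. (-1) ^ (m + i) * real (m choose i) * g (t + real i * h))" for t
  define \<phi>' where "\<phi>' t = (\<Sum>i\<le>m. (-1) ^ (m + i) * real (m choose i) * deriv g (t + real i * h))" for t
  have range: "t + real i * h \<in> {x..x + real (Suc m) * h}" if "t \<in> {x..x+h}" "i \<le> m" for t i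
  proof -
    have "real i * h \<le> real m * h" "0 \<le> real i * h"
      using that \<open>h > 0\<close> by (auto intro: mult_right_mono)
    then show ?thesis
      using that unfolding atLeastAtMost_iff of_nat_Suc distrib_right by linarith
  qed
  have D: "(\<phi> has_real_derivative \<phi>' t) (at t)" if "t \<in> {x..x+h}" for t
  proof -
    have "((\<lambda>t. g (t + real i * h)) has_real_derivative deriv g (t + real i * h)) (at t)"
      if "i \<le> m" for i
    proof -
      have "g field_differentiable at (t + real i * h)"
        using Suc.prems[of 0] range[OF \<open>t \<in> {x..x+h}\<close> that] by simp
      then show ?thesis
        using DERIV_shift field_differentiable_derivI by blast
    qed
    then show ?thesis
      unfolding \<phi>_def[abs_def] \<phi>'_def by (intro DERIV_sum DERIV_cmult) auto
  qed
  obtain \<eta> where \<eta>: "x < \<eta>" "\<eta> < x + h" "\<phi> (x + h) - \<phi> x = h * \<phi>' \<eta>"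
    using MVT2[of x "x+h" \<phi> \<phi>'] D \<open>h > 0\<close> by auto
  have "(deriv ^^ j) (deriv g) field_differentiable at t"
    if "j < m" "t \<in> {\<eta>..\<eta> + real m * h}" for j t
    using Suc.prems[of "Suc j" t] that \<eta> by (auto simp: funpow_Suc_right algebra_simps simp del: funpow.simps)
  from Suc.IH[OF this] obtain \<xi> where \<xi>: "\<xi> \<in> {\<eta>..\<eta> + real m * h}"
      "\<phi>' \<eta> = h ^ m * (deriv ^^ m) (deriv g) \<xi>"
    unfolding \<phi>'_def by blast
  have "(\<Sum>i\<le>Suc m. (-1) ^ (Suc m + i) * real (Suc m choose i) * g (x + real i * h)) = \<phi> (x + h) - \<phi> x"
    unfolding alternating_binomial_sum_Suc \<phi>_def
    by (simp add: sum_subtractf right_diff_distrib algebra_simps)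
  also have "\<dots> = h ^ Suc m * (deriv ^^ Suc m) g \<xi>"
    using \<eta>(3) \<xi>(2) by (simp add: funpow_Suc_right del: funpow.simps)
  finally show ?case
    using \<xi>(1) \<eta> by (intro bexI[of _ \<xi>]) (auto simp: algebra_simps)
qed

text \<open>The factors with j < l multiply to l!, those with j > l to (m-l)! up to the sign
  (-1)^(m-l). The sign is written with m+l, which has the same parity. The induction starts at m = l
  and adds one negative factor per step.\<close>

lemma prod_of_nat_diff_others:
  assumes "l \<le> m"
  shows "(\<Prod>j\<in>{..m} - {l}. real l - real j) = (-1) ^ (m + l) * fact l * fact (m - l)"
  using assms
proof (induction m rule: dec_induct)
  case base
  have "(\<Prod>j<l. real l - real j) = (\<Prod>j<l. real (Suc j))"
    by (subst prod.nat_diff_reindex[symmetric]) (auto intro!: prod.cong simp: of_nat_diff)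
  also have "\<dots> = fact l"
    by (simp add: fact_prod_Suc atLeast0LessThan)
  finally have "(\<Prod>j<l. real l - real j) = fact l" .
  moreover have "{..l} - {l} = {..<l}"
    by auto
  ultimately show ?case
    by (simp flip: mult_2)
next
  case (step m)
  have "{..Suc m} - {l} = insert (Suc m) ({..m} - {l})"
    using step by auto
  then have "(\<Prod>j\<in>{..Suc m} - {l}. real l - real j) =
      (real l - real (Suc m)) * ((-1) ^ (m + l) * fact l * fact (m - l))"
    using step by simp
  also have "\<dots> = (-1) ^ (Suc m + l) * fact l * fact (Suc m - l)"
    using step by (simp add: Suc_diff_le of_nat_diff algebra_simps)
  finally show ?case .
qed

text \<open>These are the Lagrange weights 1/P'(a_i) of the divided difference. For equispaced nodes
  they are alternating binomial coefficients up to a common factor, so the divided difference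
  becomes a finite difference.\<close>

lemma equispaced_weight:
  assumes "h \<noteq> 0" "l \<le> m"
  shows "1 / (\<Prod>j\<in>{1..Suc m} - {Suc l}. (x + real (Suc l) * h) - (x + real j * h)) =
    (-1) ^ (m + l) * real (m choose l) / (h ^ m * fact m)"
proof -
  have "(\<Prod>j\<in>{1..Suc m} - {Suc l}. (x + real (Suc l) * h) - (x + real j * h)) =
      (\<Prod>j\<in>{..m} - {l}. h * (real l - real j))"
    by (rule prod.reindex_bij_witness[of _ Suc "\<lambda>j. j - 1"]) (auto simp: algebra_simps)
  also have "\<dots> = h ^ m * ((-1) ^ (m + l) * fact l * fact (m - l))"
    using assms by (simp add: prod.distrib prod_of_nat_diff_others)
  finally have *: "(\<Prod>j\<in>{1..Suc m} - {Suc l}. (x + real (Suc l) * h) - (x + real j * h)) =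
      h ^ m * ((-1) ^ (m + l) * fact l * fact (m - l))" .
  have "(-1 :: real) ^ (m + l) * (-1) ^ (m + l) = 1"
    by (simp flip: power_add mult_2)
  then show ?thesis
    unfolding * binomial_fact[OF \<open>l \<le> m\<close>] using \<open>h \<noteq> 0\<close>
    by (simp add: divide_simps)
qed

section \<open>Vieta's formulas and the perturbation of one coefficient\<close>

lemma prod_diff_eq_elem_sym:
  "(\<Prod>i=1..n. t - y i) = (\<Sum>j\<le>n. (-1) ^ (n - j) * elem_sym n j y * t ^ j)"
proof -
  have "(\<Prod>i=1..n. t - y i) = (\<Prod>i=1..n. - y i + t)"
    by simp
  also have "\<dots> = (\<Sum>B\<in>Pow {1..n}. (\<Prod>i\<in>B. - y i) * (\<Prod>i\<in>{1..n} - B. t))"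
    by (rule prod_add) auto
  \<comment> \<open>\<open>B\<close> marks the factors that contribute - y i, so the exponent of
    \<open>t\<close> is n - card B. Grouping by this exponent j leaves the sets of size n - j, those
    over which \<open>elem_sym n j\<close> sums.\<close>
  also have "\<dots> = (\<Sum>j\<le>n. \<Sum>B\<in>{B \<in> Pow {1..n}. n - card B = j}. (\<Prod>i\<in>B. - y i) * (\<Prod>i\<in>{1..n} - B. t))"
    by (rule sum.group[symmetric]) auto
  also have "\<dots> = (\<Sum>j\<le>n. (-1) ^ (n - j) * elem_sym n j y * t ^ j)"
  proof (rule sum.cong[OF refl])
    fix j assume j: "j \<in> {..n}"
    have card: "card B \<le> n" "finite B" if "B \<subseteq> {1..n}" for B
      using card_mono[OF _ that] finite_subset[OF that] by auto
    have "{B \<in> Pow {1..n}. n - card B = j} = {A. A \<subseteq> {1..n} \<and> card A = n - j}"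
      using card j by fastforce
    then have "(\<Sum>B\<in>{B \<in> Pow {1..n}. n - card B = j}. (\<Prod>i\<in>B. - y i) * (\<Prod>i\<in>{1..n} - B. t)) =
      (\<Sum>B | B \<subseteq> {1..n} \<and> card B = n - j. (-1) ^ (n - j) * (\<Prod>i\<in>B. y i) * t ^ j)"
      using j by (intro sum.cong) (auto simp: card_Diff_subset card prod_uminus)
    then show "(\<Sum>B\<in>{B \<in> Pow {1..n}. n - card B = j}. (\<Prod>i\<in>B. - y i) * (\<Prod>i\<in>{1..n} - B. t)) =
        (-1) ^ (n - j) * elem_sym n j y * t ^ j"
      by (simp add: elem_sym_def sum_distrib_left sum_distrib_right)
  qed
  finally show ?thesis .
qed

text \<open>The index \<open>n\<close> belongs to the leading coefficient; this value makes the
  terms of degree \<open>n\<close> cancel when two such products are subtracted.\<close>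

lemma elem_sym_degree_0: "elem_sym n n y = 1"
proof -
  have "{A. A \<subseteq> {1..n} \<and> card A = 0} = {{}}"
    by (auto dest: finite_subset)
  then show ?thesis
    by (simp add: elem_sym_def)
qed

text \<open>The perturbed polynomial is still monic of degree \<open>n\<close> because k < n, so its
  \<open>n\<close> distinct roots determine it and coefficients can be compared. The factor
  (-1)^(n-k) cancels the sign in Vieta's formula, so E_k grows by exactly \<open>e\<close>.\<close>

lemma elem_sym_of_perturbed_roots:
  assumes "k < n" "inj_on b {1..n}"
    and root: "\<And>i. i \<in> {1..n} \<Longrightarrow> (\<Prod>j=1..n. b i - a j) + e * ((-1) ^ (n - k) * b i ^ k) = 0"
    and "j < n"
  shows "elem_sym n j b = elem_sym n j a + (if j = k then e else 0)"
proof (rule ccontr)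
  assume ne: "\<not> ?thesis"
  obtain m where n: "n = Suc m"
    using \<open>k < n\<close> by (cases n) auto
  \<comment> \<open>Coefficient of t^l in the perturbed polynomial minus the product of the factors
    t - b i.\<close>
  define c where "c l = (-1) ^ (n - l) * (elem_sym n l a - elem_sym n l b + (if l = k then e else 0))" for l
  have "(\<Sum>l\<le>m. c l * b i ^ l) = 0" if i: "i \<in> {1..n}" for i
  proof -
    have "(\<Prod>j=1..n. b i - b j) = 0"
      using i by auto
    then have "(\<Prod>j=1..n. b i - a j) - (\<Prod>j=1..n. b i - b j) =
      - (e * ((-1) ^ (n - k) * b i ^ k))"
      using root[OF i] by linarith
    moreover have "(\<Prod>j=1..n. b i - a j) - (\<Prod>j=1..n. b i - b j) =
      (\<Sum>l\<le>m. (-1) ^ (n - l) * (elem_sym n l a - elem_sym n l b) * b i ^ l)"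
      unfolding prod_diff_eq_elem_sym n
      by (simp add: elem_sym_degree_0[unfolded n] algebra_simps sum_subtractf)
    moreover have "(\<Sum>l\<le>m. if l = k then e * ((-1) ^ (n - k) * b i ^ k) else 0) =
      e * ((-1) ^ (n - k) * b i ^ k)"
      using \<open>k < n\<close> n by simp
    ultimately have "(\<Sum>l\<le>m. (-1) ^ (n - l) * (elem_sym n l a - elem_sym n l b) * b i ^ l +
       (if l = k then e * ((-1) ^ (n - k) * b i ^ k) else 0)) = 0"
      by (simp add: sum.distrib)
    moreover have "c l * b i ^ l = (-1) ^ (n - l) * (elem_sym n l a - elem_sym n l b) * b i ^ l +
       (if l = k then e * ((-1) ^ (n - k) * b i ^ k) else 0)" for l
      by (simp add: c_def algebra_simps)
    ultimately show ?thesis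
      by simp
  qed
  \<comment> \<open>The degree-\<open>n\<close> terms cancel, so \<open>n\<close> distinct roots force all coefficients \<open>c l\<close> to vanish.\<close>
  then have sub: "b ` {1..n} \<subseteq> {z. (\<Sum>l\<le>m. c l * z ^ l) = 0}"
    by blast
  have "\<exists>l. l \<le> m \<and> c l \<noteq> 0"
    using ne \<open>j < n\<close> n by (intro exI[of _ j]) (auto simp: c_def)
  from polyfun_rootbound[OF this]
  have "card (b ` {1..n}) \<le> m"
    using card_mono[OF _ sub] by linarith
  then show False
    using card_image[OF \<open>inj_on b {1..n}\<close>] n by simp
qed

text \<open>At a simple root \<open>P\<close> changes sign, so it takes values of opposite sign at r
  - h and r + h. A small perturbation preserves both signs, and the intermediate value theorem gives
  a root in between.\<close>

lemma perturbed_root_exists: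
  fixes P q :: "real \<Rightarrow> real"
  assumes D: "(P has_real_derivative D) (at r)" "D \<noteq> 0" "P r = 0"
    and cont: "continuous_on UNIV P" "continuous_on UNIV q" and "\<delta> > 0"
  shows "\<forall>\<^sub>F e in at_right 0. \<exists>z. \<bar>z - r\<bar> < \<delta> \<and> P z + e * q z = 0"
proof -
  have pos: "\<forall>\<^sub>F e in at_right 0. \<exists>z. \<bar>z - r\<bar> < \<delta> \<and> P z + e * q z = 0"
    if D: "(P has_real_derivative D) (at r)" "D > 0" "P r = 0"
      and cont: "continuous_on UNIV P" "continuous_on UNIV q" for P q :: "real \<Rightarrow> real" and D
  proof -
    obtain d1 where d1: "d1 > 0" "\<And>h. h > 0 \<Longrightarrow> h < d1 \<Longrightarrow> P r < P (r + h)"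
      using DERIV_pos_inc_right[OF D(1,2)] by blast
    obtain d2 where d2: "d2 > 0" "\<And>h. h > 0 \<Longrightarrow> h < d2 \<Longrightarrow> P (r - h) < P r"
      using DERIV_pos_inc_left[OF D(1,2)] by blast
    define h where "h = min (min d1 d2) \<delta> / 2"
    have h: "h > 0" "h < d1" "h < d2" "h < \<delta>"
      using d1(1) d2(1) \<open>\<delta> > 0\<close> by (auto simp: h_def min_def)
    have "((\<lambda>e. P z + e * q z) \<longlongrightarrow> P z + 0 * q z) (at_right 0)" for z
      by (intro tendsto_intros)
    then have lim: "((\<lambda>e. P z + e * q z) \<longlongrightarrow> P z) (at_right 0)" for z
      by simp
    have "\<forall>\<^sub>F e in at_right 0. P (r + h) + e * q (r + h) > 0"
      using d1(2)[OF h(1,2)] \<open>P r = 0\<close> by (intro order_tendstoD(1)[OF lim]) simp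
    moreover have "\<forall>\<^sub>F e in at_right 0. P (r - h) + e * q (r - h) < 0"
      using d2(2)[OF h(1,3)] \<open>P r = 0\<close> by (intro order_tendstoD(2)[OF lim]) simp
    ultimately show ?thesis
    proof eventually_elim
      case (elim e)
      have "continuous_on {r - h..r + h} (\<lambda>z. P z + e * q z)"
        using cont by (intro continuous_intros) (auto intro: continuous_on_subset)
      then obtain z where "r - h \<le> z" "z \<le> r + h" "P z + e * q z = 0"
        using IVT'[of "\<lambda>z. P z + e * q z" "r - h" 0 "r + h"] elim h by force
      then show ?case
        using h by (intro exI[of _ z]) auto
    qed
  qed
  show ?thesis
  proof (cases "D > 0")
    case True
    then show ?thesis
      using pos assms by blast
  next
    case False
    \<comment> \<open>Negating both \<open>P\<close> and \<open>q\<close> keeps the root equation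
      and makes the derivative positive.\<close>
    have "\<forall>\<^sub>F e in at_right 0. \<exists>z. \<bar>z - r\<bar> < \<delta> \<and> - P z + e * - q z = 0"
      using False assms by (intro pos[where D = "- D"]) (auto intro!: derivative_intros continuous_intros)
    then show ?thesis
      by eventually_elim (auto simp: algebra_simps add_eq_0_iff)
  qed
qed

text \<open>Caratheodory's form of the derivative gives f(t) - f(r) = \<phi>(t)(t-r) and P(t) =
  \<psi>(t)(t-r). The root equation then yields z - r = - e q(z) / \<psi>(z), so the quotient equals
  - \<phi>(z) q(z) / \<psi>(z). There is no division by z - r, so z = r is harmless.\<close>

lemma perturbed_root_difference_quotient:
  fixes P q f :: "real \<Rightarrow> real"
  assumes P: "(P has_real_derivative D) (at r)" "D \<noteq> 0" "P r = 0"
    and q: "isCont q r" and f: "(f has_real_derivative f') (at r)"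
    and z: "z \<longlonglongrightarrow> r" and root: "\<And>m. P (z m) + e m * q (z m) = 0" and e: "\<And>m. e m \<noteq> 0"
  shows "(\<lambda>m. (f (z m) - f r) / e m) \<longlonglongrightarrow> - (f' * q r / D)"
proof -
  obtain \<phi> where \<phi>: "\<And>t. f t - f r = \<phi> t * (t - r)" "isCont \<phi> r" "\<phi> r = f'"
    using f unfolding CARAT_DERIV by blast
  obtain \<psi> where \<psi>: "\<And>t. P t - P r = \<psi> t * (t - r)" "isCont \<psi> r" "\<psi> r = D"
    using P(1) unfolding CARAT_DERIV by blast
  have lims: "(\<lambda>m. \<phi> (z m)) \<longlonglongrightarrow> f'" "(\<lambda>m. \<psi> (z m)) \<longlonglongrightarrow> D" "(\<lambda>m. q (z m)) \<longlonglongrightarrow> q r"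
    using isCont_tendsto_compose[OF _ z] \<phi> \<psi> q by blast+
  have "\<forall>\<^sub>F m in sequentially. \<psi> (z m) \<noteq> 0"
    using tendsto_imp_eventually_ne[OF lims(2) \<open>D \<noteq> 0\<close>] .
  then have "\<forall>\<^sub>F m in sequentially. - (\<phi> (z m) * q (z m) / \<psi> (z m)) = (f (z m) - f r) / e m"
  proof eventually_elim
    case (elim m)
    have "\<psi> (z m) * (z m - r) = - (e m * q (z m))"
      using root[of m] \<psi>(1)[of "z m"] P(3) by simp
    then have "z m - r = - (e m * q (z m)) / \<psi> (z m)"
      using elim by (simp add: field_simps)
    then show ?case
      unfolding \<phi>(1) using e[of m] by simp
  qed
  moreover have "(\<lambda>m. - (\<phi> (z m) * q (z m) / \<psi> (z m))) \<longlonglongrightarrow> - (f' * q r / D)"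
    by (intro tendsto_intros lims \<open>D \<noteq> 0\<close>)
  ultimately show ?thesis
    by (rule Lim_transform_eventually[rotated])
qed

section \<open>The sign of divided differences of t^k f'(t)\<close>

lemma divided_difference_sign:
  fixes f :: "real \<Rightarrow> real"
  assumes "open I" "S \<subseteq> {0..n - 1}" "k \<in> S" "n \<ge> 1"
    and diff: "\<And>x. x \<in> I \<Longrightarrow> f field_differentiable at x"
    and mono: "\<And>a b. a \<in> ordered_tuples n I \<Longrightarrow> b \<in> ordered_tuples n I \<Longrightarrow>
           (\<forall>k\<in>S. elem_sym n k a \<le> elem_sym n k b) \<Longrightarrow>
           (\<forall>k\<in>{0..n - 1} - S. elem_sym n k a = elem_sym n k b) \<Longrightarrow>
           (\<Sum>i=1..n. f (a i)) \<le> (\<Sum>i=1..n. f (b i))"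
    and a: "strict_mono_on {1..n} a" "a \<in> {1..n} \<rightarrow>\<^sub>E I"
  shows "(-1) ^ (n + k) * (\<Sum>i=1..n. a i ^ k * deriv f (a i) / (\<Prod>j\<in>{1..n} - {i}. a i - a j)) \<le> 0"
proof -
  have "k < n"
    using assms by auto
  define P where "P t = (\<Prod>j=1..n. t - a j)" for t
  define D where "D i = (\<Prod>j\<in>{1..n} - {i}. a i - a j)" for i
  define q where "q t = (-1) ^ (n - k) * t ^ k" for t :: real
  have inj: "inj_on a {1..n}"
    using a(1) by (rule strict_mono_on_imp_inj_on)
  have D0: "D i \<noteq> 0" if "i \<in> {1..n}" for i
    using inj_onD[OF inj _ that] by (auto simp: D_def)
  have P0: "P (a i) = 0" if "i \<in> {1..n}" for i
    using that unfolding P_def by auto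
  \<comment> \<open>The Caratheodory slope of \<open>P\<close> at a root is the product of the
    remaining factors, so \<open>D i\<close> is P'(a_i).\<close>
  have PD: "(P has_real_derivative D i) (at (a i))" if "i \<in> {1..n}" for i
    unfolding CARAT_DERIV
  proof (intro exI[of _ "\<lambda>t. \<Prod>j\<in>{1..n} - {i}. t - a j"] conjI allI)
    show "P t - P (a i) = (\<Prod>j\<in>{1..n} - {i}. t - a j) * (t - a i)" for t
      using that P0[OF that] unfolding P_def by (subst prod.remove[of _ i]) auto
  qed (auto simp: D_def intro!: continuous_intros)
  have cont: "continuous_on UNIV P" "continuous_on UNIV q"
    unfolding P_def[abs_def] q_def[abs_def] by (intro continuous_intros)+
  \<comment> \<open>Finitely many eventual conditions hold together, so one \<open>e\<close> serves
    all the roots. The radius 1/(m+1) makes the chosen roots converge to the nodes.\<close>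
  have "\<exists>e z. 0 < e \<and> (\<forall>i\<in>{1..n}. \<bar>z i - a i\<bar> < inverse (real (Suc m)) \<and> P (z i) + e * q (z i) = 0)" for m
  proof -
    have "\<forall>\<^sub>F e in at_right 0. \<exists>z. \<bar>z - a i\<bar> < inverse (real (Suc m)) \<and> P z + e * q z = 0"
      if "i \<in> {1..n}" for i
      using perturbed_root_exists[OF PD[OF that] D0[OF that] P0[OF that] cont] by simp
    then have "\<forall>\<^sub>F e in at_right 0. \<forall>i\<in>{1..n}. \<exists>z. \<bar>z - a i\<bar> < inverse (real (Suc m)) \<and> P z + e * q z = 0"
      by (intro eventually_ball_finite) auto
    moreover have "\<forall>\<^sub>F e in at_right (0::real). 0 < e"
      by (simp add: eventually_at_right_less)
    ultimately have "\<forall>\<^sub>F e in at_right 0. 0 < e \<and>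
        (\<forall>i\<in>{1..n}. \<exists>z. \<bar>z - a i\<bar> < inverse (real (Suc m)) \<and> P z + e * q z = 0)"
      by eventually_elim blast
    from eventually_happens'[OF _ this] show ?thesis
      by (auto simp: bchoice_iff)
  qed
  then obtain e z where e: "\<And>m. 0 < e m"
    and near: "\<And>m i. i \<in> {1..n} \<Longrightarrow> \<bar>z m i - a i\<bar> < inverse (real (Suc m))"
    and root: "\<And>m i. i \<in> {1..n} \<Longrightarrow> P (z m i) + e m * q (z m i) = 0"
    by metis
  have zlim: "(\<lambda>m. z m i) \<longlonglongrightarrow> a i" if "i \<in> {1..n}" for i
  proof -
    have "(\<lambda>m. z m i - a i) \<longlonglongrightarrow> 0"
      using near[OF that] by (intro Lim_null_comparison[OF _ LIMSEQ_inverse_real_of_nat] always_eventually)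
        (auto intro: less_imp_le)
    then show ?thesis
      by (simp add: LIM_zero_iff)
  qed
  have "(\<lambda>m. (f (z m i) - f (a i)) / e m) \<longlonglongrightarrow> - (deriv f (a i) * q (a i) / D i)" if i: "i \<in> {1..n}" for i
  proof (rule perturbed_root_difference_quotient[OF PD D0 P0 _ _ zlim root])
    show "isCont q (a i)"
      using cont by (simp add: continuous_on_eq_continuous_at)
    show "(f has_real_derivative deriv f (a i)) (at (a i))"
      using a(2) i by (auto intro!: field_differentiable_derivI diff)
    show "e m \<noteq> 0" for m
      using e[of m] by simp
  qed (use i in auto)
  then have "(\<lambda>m. \<Sum>i=1..n. (f (z m i) - f (a i)) / e m) \<longlonglongrightarrow> (\<Sum>i=1..n. - (deriv f (a i) * q (a i) / D i))"
    by (intro tendsto_sum) auto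
  moreover have "\<forall>\<^sub>F m in sequentially. 0 \<le> (\<Sum>i=1..n. (f (z m i) - f (a i)) / e m)"
  proof -
    have "\<forall>\<^sub>F m in sequentially. z m i \<in> I" if "i \<in> {1..n}" for i
      using zlim[OF that] \<open>open I\<close> PiE_mem[OF a(2) that] by (rule topological_tendstoD)
    then have "\<forall>\<^sub>F m in sequentially. \<forall>i\<in>{1..n}. z m i \<in> I"
      by (intro eventually_ball_finite) auto
    \<comment> \<open>Since the nodes are strictly ordered, nearby roots inherit the order. This
      makes the perturbed tuple both admissible and free of repeated entries, as the comparison of
      coefficients requires.\<close>
    moreover have "\<forall>\<^sub>F m in sequentially. z m i < z m j" if "i \<in> {1..n}" "j \<in> {1..n}" "i < j" for i j
    proof -
      have "a i < a j"
        using a(1) that by (auto simp: strict_mono_on_def)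
      then have "(\<lambda>m. z m j - z m i) \<longlonglongrightarrow> a j - a i" "0 < a j - a i"
        using zlim that by (auto intro!: tendsto_diff)
      from order_tendstoD(1)[OF this] show ?thesis
        by simp
    qed
    then have "\<forall>\<^sub>F m in sequentially. \<forall>i\<in>{1..n}. \<forall>j\<in>{1..n}. i < j \<longrightarrow> z m i < z m j"
      by (intro eventually_ball_finite ballI) (auto intro: always_eventually)
    ultimately show ?thesis
    proof eventually_elim
      case (elim m)
      \<comment> \<open>Members of \<open>ordered_tuples\<close> are extensional, and
        \<open>z m\<close> is uncontrolled outside the index set.\<close>
      define b where "b = restrict (z m) {1..n}"
      have b: "b i = z m i" if "i \<in> {1..n}" for i
        using that by (simp add: b_def)
      have b_mono: "strict_mono_on {1..n} b"
        using elim(2) b by (auto simp: strict_mono_on_def)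
      have E: "elem_sym n j b = elem_sym n j a + (if j = k then e m else 0)" if "j < n" for j
        using \<open>k < n\<close> strict_mono_on_imp_inj_on[OF b_mono] _ that
        by (rule elem_sym_of_perturbed_roots) (use root b in \<open>auto simp: P_def q_def\<close>)
      have "(\<Sum>i=1..n. f (a i)) \<le> (\<Sum>i=1..n. f (b i))"
      proof (rule mono)
        show "a \<in> ordered_tuples n I"
          using a strict_mono_on_imp_mono_on by (auto simp: ordered_tuples_def)
        show "b \<in> ordered_tuples n I"
          using b_mono strict_mono_on_imp_mono_on elim(1)
          by (auto simp: ordered_tuples_def b_def)
        show "\<forall>k\<in>S. elem_sym n k a \<le> elem_sym n k b"
          using E e[of m] \<open>S \<subseteq> _\<close> \<open>n \<ge> 1\<close> by fastforce
        \<comment> \<open>Only the coefficient with the fixed index \<open>k\<close> moves, and that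
          index lies in \<open>S\<close>.\<close>
        show "\<forall>k\<in>{0..n - 1} - S. elem_sym n k a = elem_sym n k b"
          using E \<open>k \<in> S\<close> \<open>n \<ge> 1\<close> by auto
      qed
      also have "(\<Sum>i=1..n. f (b i)) = (\<Sum>i=1..n. f (z m i))"
        using b by simp
      finally have "0 \<le> (\<Sum>i=1..n. f (z m i) - f (a i))"
        by (simp add: sum_subtractf)
      then show ?case
        using e[of m] by (simp flip: sum_divide_distrib)
    qed
  qed
  ultimately have "0 \<le> (\<Sum>i=1..n. - (deriv f (a i) * q (a i) / D i))"
    by (rule tendsto_lowerbound) simp
  also have "\<dots> = - ((-1) ^ (n - k) * (\<Sum>i=1..n. a i ^ k * deriv f (a i) / D i))"
    by (simp add: q_def sum_negf sum_distrib_left mult_ac)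
  also have "(-1) ^ (n - k) = ((-1) ^ (n + k) :: real)"
    using \<open>k < n\<close> by (simp add: uminus_power_if)
  finally show ?thesis
    by (simp add: D_def)
qed

section \<open>Passage to the derivative by shrinking equispaced nodes\<close>

theorem theorem2p4:
  fixes n :: nat and I :: "real set" and S :: "nat set" and f :: "real \<Rightarrow> real"
  assumes "n \<ge> 2"
    and "open I" and "is_interval I"
    and "S \<subseteq> {0..n - 1}"
    and "C_on n I f"
    and "\<And>a b. a \<in> ordered_tuples n I \<Longrightarrow> b \<in> ordered_tuples n I \<Longrightarrow>
           (\<forall>k\<in>S. elem_sym n k a \<le> elem_sym n k b) \<Longrightarrow>
           (\<forall>k\<in>{0..n - 1} - S. elem_sym n k a = elem_sym n k b) \<Longrightarrow>
           (\<Sum>i=1..n. f (a i)) \<le> (\<Sum>i=1..n. f (b i))"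
  shows "\<forall>x\<in>I. \<forall>k\<in>S. (-1) ^ (n + k) * (deriv ^^ (n - 1)) (\<lambda>t. t ^ k * deriv f t) x \<le> 0"
proof (intro ballI)
  fix x k assume "x \<in> I" "k \<in> S"
  obtain m where n: "n = Suc m"
    using \<open>n \<ge> 2\<close> by (cases n) auto
  define g where "g t = t ^ k * deriv f t" for t
  define G where "G t = (-1) ^ (n + k) * (deriv ^^ m) g t" for t
  have f: "\<forall>t\<in>I. f field_differentiable at t" "C_on m I (deriv f)"
    using \<open>C_on n I f\<close> by (auto simp: n C_on_Suc)
  have g: "C_on m I g"
    unfolding g_def by (intro C_on_mult C_on_power f \<open>open I\<close>)
  \<comment> \<open>The mean value argument controls \<open>G\<close> only at some point near
    \<open>x\<close>; continuity of \<open>G\<close> transfers the sign to \<open>x\<close> at the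
    end.\<close>
  have nonpos: "\<exists>\<xi>. \<bar>\<xi> - x\<bar> < \<delta> \<and> G \<xi> \<le> 0" if "\<delta> > 0" for \<delta>
  proof -
    obtain d where d: "d > 0" "ball x d \<subseteq> I"
      using \<open>open I\<close> \<open>x \<in> I\<close> open_contains_ball by blast
    \<comment> \<open>Dividing by n + 1 gives n h < min d \<delta>, so all nodes x + h, ..., x + n h
      lie in \<open>I\<close> and within \<delta> of \<open>x\<close>.\<close>
    define h where "h = min d \<delta> / real (Suc n)"
    have "h > 0"
      using d \<open>\<delta> > 0\<close> by (simp add: h_def)
    have "real (Suc n) * h = min d \<delta>"
      by (simp add: h_def)
    then have "real n * h < min d \<delta>"
      using \<open>h > 0\<close> unfolding of_nat_Suc distrib_right by linarith
    then have near: "\<bar>t - x\<bar> < min d \<delta>" if "t \<in> {x + h..x + h + real m * h}" for t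
      using that \<open>h > 0\<close> by (auto simp: n algebra_simps)
    then have in_I: "t \<in> I" if "t \<in> {x + h..x + h + real m * h}" for t
      using that d(2) by (force simp: dist_real_def)
    define a where "a = restrict (\<lambda>i. x + real i * h) {1..n}"
    have range: "x + real (Suc l) * h \<in> {x + h..x + h + real m * h}" if "l \<le> m" for l
      using that \<open>h > 0\<close> by (auto simp: algebra_simps intro: mult_right_mono)
    have "a i \<in> I" if "i \<in> {1..n}" for i
      using in_I[OF range[of "i - 1"]] that by (auto simp: a_def n)
    then have "a \<in> {1..n} \<rightarrow>\<^sub>E I"
      by (auto simp: a_def)
    moreover have "strict_mono_on {1..n} a"
      using \<open>h > 0\<close> by (auto simp: strict_mono_on_def a_def)
    ultimately have "(-1) ^ (n + k) * (\<Sum>i=1..n. a i ^ k * deriv f (a i) / (\<Prod>j\<in>{1..n} - {i}. a i - a j)) \<le> 0"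
      using assms(1,2,4,6) \<open>k \<in> S\<close> f(1) by (intro divided_difference_sign[where S = S and I = I]) auto
    \<comment> \<open>Tuples are indexed from 1, finite differences from 0. Reindexing by i = l + 1
      makes x + h the base point of the finite difference.\<close>
    also have "(\<Sum>i=1..n. a i ^ k * deriv f (a i) / (\<Prod>j\<in>{1..n} - {i}. a i - a j)) =
        (\<Sum>l\<le>m. g (x + real (Suc l) * h) *
          (1 / (\<Prod>j\<in>{1..Suc m} - {Suc l}. (x + real (Suc l) * h) - (x + real j * h))))"
      by (rule sum.reindex_bij_witness[of _ Suc "\<lambda>i. i - 1"]) (auto simp: a_def g_def n)
    also have "\<dots> = (\<Sum>l\<le>m. g (x + real (Suc l) * h) * ((-1) ^ (m + l) * real (m choose l) / (h ^ m * fact m)))"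
      using \<open>h > 0\<close> by (intro sum.cong refl arg_cong2[where f = "(*)"] equispaced_weight) auto
    also have "\<dots> = (\<Sum>l\<le>m. (-1) ^ (m + l) * real (m choose l) * g (x + h + real l * h)) / (h ^ m * fact m)"
      by (simp add: sum_divide_distrib algebra_simps)
    finally have le: "(-1) ^ (n + k) *
      ((\<Sum>l\<le>m. (-1) ^ (m + l) * real (m choose l) * g (x + h + real l * h)) / (h ^ m * fact m)) \<le> 0" .
    obtain \<xi> where \<xi>: "\<xi> \<in> {x + h..x + h + real m * h}"
      "(\<Sum>l\<le>m. (-1) ^ (m + l) * real (m choose l) * g (x + h + real l * h)) = h ^ m * (deriv ^^ m) g \<xi>"
      using finite_difference_mean_value[OF \<open>h > 0\<close>, of m "x + h" g] g in_I unfolding C_on_def by blast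
    \<comment> \<open>The factor h^m from the mean value form cancels the one in the Lagrange
      weights.\<close>
    have "G \<xi> / fact m \<le> 0"
      using le \<open>h > 0\<close> unfolding \<xi>(2) G_def by simp
    then have "G \<xi> \<le> 0"
      by (simp add: pos_divide_le_eq)
    then show ?thesis
      using near[OF \<xi>(1)] by auto
  qed
  have "isCont G x"
    using g \<open>x \<in> I\<close> \<open>open I\<close> unfolding G_def C_on_def
    by (auto intro!: continuous_intros simp: continuous_on_eq_continuous_at)
  have "G x \<le> 0"
  proof (rule ccontr)
    assume "\<not> G x \<le> 0"
    then have "\<forall>\<^sub>F t in nhds x. G t > 0"
      using \<open>isCont G x\<close> by (intro order_tendstoD(1)) (auto simp: isCont_def tendsto_at_iff_tendsto_nhds)
    then obtain \<delta> where "\<delta> > 0" "\<And>t. \<bar>t - x\<bar> < \<delta> \<Longrightarrow> G t > 0"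
      by (auto simp: eventually_nhds_metric dist_real_def)
    then show False
      using nonpos[of \<delta>] by force
  qed
  then show "(-1) ^ (n + k) * (deriv ^^ (n - 1)) (\<lambda>t. t ^ k * deriv f t) x \<le> 0"
    by (simp add: G_def g_def[abs_def] n)
qed

end
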